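(* Let $p$ be a prime, $n,m\ge 1$ integers, and $F:\mathbb{F}_{p^n}\to\mathbb{F}_{p^m}$ any function. For every $u\in\mathbb{F}_{p^n}$, $v\in\mathbb{F}_{p^m}$ and $j\in\mathbb{F}_p$, $$N_F(u,v;j)=\sum_{\substack{b\in\mathbb{F}_{p^m}\\ \mathrm{Tr}_1^m(vb)=j}}\mathrm{DDT}_F(u,b).$$ Consequently, $$L_F(u,v;j)=\sum_{\substack{b\in\mathbb{F}_{p^m}\\ \mathrm{Tr}_1^m(vb)=j}}\mathrm{DDT}_F(u,b)-p^{n-1}.$$
   Context: $\mathrm{Tr}_1^m$ is the absolute trace $\mathbb{F}_{p^m}\to\mathbb{F}_p$. The derivative is $D_uF(x)=F(x+u)-F(x)$. The differential distribution table is $\mathrm{DDT}_F(u,b)=\#\{x\in\mathbb{F}_{p^n}:D_uF(x)=b\}$. The level count is $N_F(u,v;j)=\#\{x\in\mathbb{F}_{p^n}:\mathrm{Tr}_1^m(vD_uF(x))=j\}$ and the centered level count is $L_F(u,v;j)=N_F(u,v;j)-p^{n-1}$. *)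

theory Defs
  imports
    "HOL-Number_Theory.Number_Theory"
    "HOL-Computational_Algebra.Polynomial"
    "HOL-Library.Cardinality"
begin

text \<open>
  The field with $p^k$ elements is rendered as a type of class \<open>finite_field\<close> with
  cardinality \<open>p ^ k\<close>. The prime field $F_p$ is identified with the prime subfield of
  $F_{p^m}$, which is where the absolute trace takes its values.
\<close>

definition prime_subfield :: "'a::field set" where
  "prime_subfield = range of_int"

definition abs_trace :: "nat \<Rightarrow> nat \<Rightarrow> 'a::finite_field \<Rightarrow> 'a" where
  "abs_trace p m x = (\<Sum>i<m. x ^ (p ^ i))"

definition derivative :: "('a::finite_field \<Rightarrow> 'b::finite_field) \<Rightarrow> 'a \<Rightarrow> 'a \<Rightarrow> 'b" where
  "derivative F u x = F (x + u) - F x"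

definition DDT :: "('a::finite_field \<Rightarrow> 'b::finite_field) \<Rightarrow> 'a \<Rightarrow> 'b \<Rightarrow> nat" where
  "DDT F u b = card {x. derivative F u x = b}"

definition level_count ::
  "nat \<Rightarrow> nat \<Rightarrow> ('a::finite_field \<Rightarrow> 'b::finite_field) \<Rightarrow> 'a \<Rightarrow> 'b \<Rightarrow> 'b \<Rightarrow> nat" where
  "level_count p m F u v j = card {x. abs_trace p m (v * derivative F u x) = j}"

definition centered_level_count ::
  "nat \<Rightarrow> nat \<Rightarrow> nat \<Rightarrow> ('a::finite_field \<Rightarrow> 'b::finite_field) \<Rightarrow> 'a \<Rightarrow> 'b \<Rightarrow> 'b \<Rightarrow> int" where
  "centered_level_count p n m F u v j = int (level_count p m F u v j) - int (p ^ (n - 1))"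

text \<open>
  The lemmas below are not needed to read the definitions; they confirm that
  \<^const>\<open>prime_subfield\<close> has \<open>p\<close> elements and that \<^const>\<open>abs_trace\<close> maps into it.
\<close>

lemma CHAR_eq_of_CARD:
  assumes "prime p" and "CARD('a::finite_field) = p ^ m"
  shows "CHAR('a) = p"
proof -
  have "CHAR('a) dvd p ^ m"
    using CHAR_dvd_CARD[where 'a = 'a] assms(2) by simp
  hence "CHAR('a) dvd p"
    using prime_dvd_power CHAR_prime by blast
  thus ?thesis
    using assms(1) CHAR_prime[where 'a = 'a] primes_dvd_imp_eq by blast
qed

lemma prime_subfield_eq:
  "(prime_subfield :: 'a::finite_field set) = of_nat ` {..<CHAR('a)}"
proof
  show "(prime_subfield :: 'a set) \<subseteq> of_nat ` {..<CHAR('a)}"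
  proof
    fix y :: 'a assume "y \<in> prime_subfield"
    then obtain k where k: "y = of_int k"
      by (auto simp: prime_subfield_def)
    define r where "r = nat (k mod int CHAR('a))"
    have r: "int r = k mod int CHAR('a)"
      by (simp add: r_def)
    have "(of_int (int r) :: 'a) = of_int k"
      unfolding of_int_eq_iff_cong_CHAR r by (simp add: cong_def)
    moreover have "int r < int CHAR('a)"
      unfolding r by simp
    ultimately show "y \<in> of_nat ` {..<CHAR('a)}"
      using k by (intro image_eqI[of _ _ r]) auto
  qed
  show "of_nat ` {..<CHAR('a)} \<subseteq> (prime_subfield :: 'a set)"
    unfolding prime_subfield_def by (metis image_subsetI of_int_of_nat_eq rangeI)
qed

lemma card_prime_subfield:
  assumes "prime p" and "CARD('a::finite_field) = p ^ m"
  shows "card (prime_subfield :: 'a set) = p"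
proof -
  have "inj_on (of_nat :: nat \<Rightarrow> 'a) {..<CHAR('a)}"
    by (intro inj_onI) (auto simp: of_nat_eq_iff_cong_CHAR cong_def)
  thus ?thesis
    by (simp add: prime_subfield_eq card_image CHAR_eq_of_CARD[OF assms])
qed

lemma prime_subfield_iff_power:
  fixes y :: "'a::finite_field"
  assumes p: "prime p" and c: "CARD('a) = p ^ m"
  shows "y \<in> prime_subfield \<longleftrightarrow> y ^ p = y"
proof -
  have char: "CHAR('a) = p"
    by (rule CHAR_eq_of_CARD[OF p c])
  have p1: "p > 1"
    using p prime_gt_1_nat by blast
  define q :: "'a poly" where "q = monom 1 p - monom 1 1"
  have q: "poly q x = x ^ p - x" for x
    by (simp add: q_def poly_monom)
  have "coeff q p = 1"
    using p1 by (simp add: q_def)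
  hence q0: "q \<noteq> 0"
    by auto
  have deg: "degree q \<le> p"
    unfolding q_def using p1 by (intro degree_diff_le degree_monom_le order.trans[OF degree_monom_le]) auto
  have sub: "prime_subfield \<subseteq> {x. poly q x = 0}"
  proof
    fix x :: 'a assume "x \<in> prime_subfield"
    then obtain k where k: "x = of_nat k"
      by (auto simp: prime_subfield_eq)
    have "(of_nat k :: 'a) ^ p = of_nat k"
    proof (induction k)
      case 0
      thus ?case using p1 by simp
    next
      case (Suc k)
      have "(1 + of_nat k :: 'a) ^ p = 1 ^ p + of_nat k ^ p"
        by (rule freshmans_dream) (simp_all add: char p)
      thus ?case
        by (simp only: of_nat_Suc Suc.IH power_one)
    qed
    thus "x \<in> {x. poly q x = 0}"
      by (simp add: q k)
  qed
  have "card {x. poly q x = 0} \<le> card (prime_subfield :: 'a set)"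
    using card_poly_roots_bound[OF q0] deg card_prime_subfield[OF p c] by simp
  hence "prime_subfield = {x. poly q x = 0}"
    using sub by (intro card_seteq) auto
  thus ?thesis
    by (auto simp: q)
qed

lemma abs_trace_in_prime_subfield:
  fixes x :: "'a::finite_field"
  assumes p: "prime p" and c: "CARD('a) = p ^ m"
  shows "abs_trace p m x \<in> prime_subfield"
proof -
  have char: "CHAR('a) = p"
    by (rule CHAR_eq_of_CARD[OF p c])
  have sum_pow: "(\<Sum>i<k. x ^ (p ^ i)) ^ p = (\<Sum>i<k. x ^ (p ^ Suc i))" for k
  proof (induction k)
    case 0
    thus ?case using prime_gt_0_nat[OF p] by simp
  next
    case (Suc k)
    have "(\<Sum>i<Suc k. x ^ (p ^ i)) ^ p = (\<Sum>i<k. x ^ (p ^ i)) ^ p + (x ^ (p ^ k)) ^ p"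
      unfolding sum.lessThan_Suc by (rule freshmans_dream) (simp_all add: char p)
    also have "(x ^ (p ^ k)) ^ p = x ^ (p ^ Suc k)"
      by (simp only: power_mult [symmetric] power_Suc2)
    finally show ?case
      by (simp only: Suc.IH sum.lessThan_Suc)
  qed
  have "x ^ (p ^ m) = x"
    using finite_field_power_card_eq_same[of x] c by simp
  moreover have "x ^ (p ^ 0) + (\<Sum>i<m. x ^ (p ^ Suc i)) = (\<Sum>i<m. x ^ (p ^ i)) + x ^ (p ^ m)"
    using sum.lessThan_Suc_shift[of "\<lambda>i. x ^ (p ^ i)" m] sum.lessThan_Suc[of "\<lambda>i. x ^ (p ^ i)" m]
    by (rule trans[OF sym])
  ultimately have "(\<Sum>i<m. x ^ (p ^ Suc i)) = (\<Sum>i<m. x ^ (p ^ i))"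
    by simp
  thus ?thesis
    unfolding prime_subfield_iff_power[OF p c] abs_trace_def sum_pow .
qed

end

theory Submission
  imports Defs
begin

text \<open>Whether x is counted depends only on the value b of \<open>derivative F u x\<close>. The
  level set is thus the disjoint union of the fibres of the derivative over those b with trace
  condition j, and \<open>DDT F u b\<close> is the size of one fibre;
  \<open>card_UN_disjoint\<close> adds the sizes up.\<close>

lemma level_count_eq_sum_DDT:
  fixes F :: "'a::finite_field \<Rightarrow> 'b::finite_field"
  shows "level_count p m F u v j = (\<Sum>b | abs_trace p m (v * b) = j. DDT F u b)"
proof -
  have "{x. abs_trace p m (v * derivative F u x) = j}
      = (\<Union>b\<in>{b. abs_trace p m (v * b) = j}. {x. derivative F u x = b})"
    by auto
  thus ?thesis
    unfolding level_count_def DDT_def by (simp only:) (rule card_UN_disjoint, auto)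
qed

theorem proposition4p1:
  fixes p n m :: nat
    and F :: "'a::finite_field \<Rightarrow> 'b::finite_field"
    and u :: 'a and v j :: 'b
  assumes "prime p" and "n \<ge> 1" and "m \<ge> 1"
    and "CARD('a) = p ^ n" and "CARD('b) = p ^ m"
    and "j \<in> prime_subfield"
  shows "level_count p m F u v j = (\<Sum>b | abs_trace p m (v * b) = j. DDT F u b)
    \<and> centered_level_count p n m F u v j
        = (\<Sum>b | abs_trace p m (v * b) = j. int (DDT F u b)) - int (p ^ (n - 1))"
  \<comment> \<open>The centered form only casts the count to \<open>int\<close>, and the cast
    commutes with the finite sum.\<close>
  by (simp add: centered_level_count_def level_count_eq_sum_DDT)

end
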